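(* Let $S$ be a $\Gamma$-semigroup with unities, let $L$ be its left operator semigroup, and let $Q$ be any non-empty set. If $\delta$ is a $Q$-fuzzy ideal (respectively $Q$-fuzzy right ideal) of $L$, then $\delta^{+}$ is a $Q$-fuzzy ideal (respectively $Q$-fuzzy right ideal) of $S$.
   Context: $\Gamma$-semigroup: non-empty sets $S$ and $\Gamma$ together with mappings $S\times\Gamma\times S\to S$, $(a,\alpha,b)\mapsto a\alpha b$, and $\Gamma\times S\times\Gamma\to\Gamma$, $(\alpha,a,\beta)\mapsto\alpha a\beta$, such that $(a\alpha b)\beta c=a(\alpha b\beta)c=a\alpha(b\beta c)$ and $\alpha(a\beta b)\gamma=(\alpha a\beta)b\gamma=\alpha a(\beta b\gamma)$ for all $a,b,c\in S$ and $\alpha,\beta,\gamma\in\Gamma$; one says $S$ is a $\Gamma$-semigroup. Operator semigroups: on $S\times\Gamma$ define the equivalence relation $(x,\alpha)\rho(y,\beta)$ iff $x\alpha s=y\beta s$ for all $s\in S$ and $\gamma x\alpha=\gamma y\beta$ for all $\gamma\in\Gamma$; write $[x,\alpha]$ for the class of $(x,\alpha)$. The left operator semigroup is $L=\{[x,\alpha]:x\in S,\alpha\in\Gamma\}$ with multiplication $[x,\alpha][y,\beta]=[x\alpha y,\beta]$. Dually, the right operator semigroup $R$ consists of the classes $[\alpha,a]$ of pairs in $\Gamma\times S$ under the relation $(\alpha,a)\sim(\beta,b)$ iff $s\alpha a=s\beta b$ for all $s\in S$ and $\alpha a\gamma=\beta b\gamma$ for all $\gamma\in\Gamma$, with multiplication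 $[\alpha,a][\beta,b]=[\alpha a\beta,b]$. A left unity of $S$ is an element $[e,\delta]\in L$ with $e\delta s=s$ for all $s\in S$; a right unity of $S$ is an element $[\gamma,f]\in R$ with $s\gamma f=s$ for all $s\in S$. "$S$ with unities" means that $S$ has a left unity and a right unity. A $Q$-fuzzy subset of a non-empty set $X$ is a function $\mu:X\times Q\to[0,1]$; it is non-empty if it is not identically $0$. A non-empty $Q$-fuzzy subset $\mu$ of $S$ is a $Q$-fuzzy left (right) ideal of $S$ if $\mu(x\gamma y,q)\ge\mu(y,q)$ (respectively $\ge\mu(x,q)$) for all $x,y\in S,\gamma\in\Gamma,q\in Q$, and a $Q$-fuzzy ideal if it is both. For a semigroup $T$ (such as $L$), a non-empty $Q$-fuzzy subset $\mu$ of $T$ is a $Q$-fuzzy left (right) ideal of $T$ if $\mu(xy,q)\ge\mu(y,q)$ (respectively $\ge\mu(x,q)$) for all $x,y\in T,q\in Q$, and a $Q$-fuzzy ideal if it is both. For a $Q$-fuzzy subset $\delta$ of $L$, the $Q$-fuzzy subset $\delta^{+}$ of $S$ is $\delta^{+}(a,q)=\inf_{\gamma\in\Gamma}\delta([a,\gamma],q)$. *)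

theory Defs
  imports Complex_Main "HOL-Library.FuncSet"
begin

locale gamma_semigroup =
  fixes S :: "'s set" and \<Gamma> :: "'g set"
    and ms :: "'s \<Rightarrow> 'g \<Rightarrow> 's \<Rightarrow> 's"
    and mg :: "'g \<Rightarrow> 's \<Rightarrow> 'g \<Rightarrow> 'g"
  assumes S_nonempty: "S \<noteq> {}"
    and \<Gamma>_nonempty: "\<Gamma> \<noteq> {}"
    and ms_closed: "\<lbrakk>a \<in> S; \<alpha> \<in> \<Gamma>; b \<in> S\<rbrakk> \<Longrightarrow> ms a \<alpha> b \<in> S"
    and mg_closed: "\<lbrakk>\<alpha> \<in> \<Gamma>; a \<in> S; \<beta> \<in> \<Gamma>\<rbrakk> \<Longrightarrow> mg \<alpha> a \<beta> \<in> \<Gamma>"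
    and ms_assoc1: "\<lbrakk>a \<in> S; b \<in> S; c \<in> S; \<alpha> \<in> \<Gamma>; \<beta> \<in> \<Gamma>\<rbrakk> \<Longrightarrow>
      ms (ms a \<alpha> b) \<beta> c = ms a (mg \<alpha> b \<beta>) c"
    and ms_assoc2: "\<lbrakk>a \<in> S; b \<in> S; c \<in> S; \<alpha> \<in> \<Gamma>; \<beta> \<in> \<Gamma>\<rbrakk> \<Longrightarrow>
      ms a (mg \<alpha> b \<beta>) c = ms a \<alpha> (ms b \<beta> c)"
    and mg_assoc1: "\<lbrakk>a \<in> S; b \<in> S; \<alpha> \<in> \<Gamma>; \<beta> \<in> \<Gamma>; \<gamma> \<in> \<Gamma>\<rbrakk> \<Longrightarrow>
      mg \<alpha> (ms a \<beta> b) \<gamma> = mg (mg \<alpha> a \<beta>) b \<gamma>"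
    and mg_assoc2: "\<lbrakk>a \<in> S; b \<in> S; \<alpha> \<in> \<Gamma>; \<beta> \<in> \<Gamma>; \<gamma> \<in> \<Gamma>\<rbrakk> \<Longrightarrow>
      mg (mg \<alpha> a \<beta>) b \<gamma> = mg \<alpha> a (mg \<beta> b \<gamma>)"

definition left_rel where
  "left_rel S \<Gamma> ms mg = {((x, \<alpha>), (y, \<beta>)).
     x \<in> S \<and> \<alpha> \<in> \<Gamma> \<and> y \<in> S \<and> \<beta> \<in> \<Gamma> \<and>
     (\<forall>s\<in>S. ms x \<alpha> s = ms y \<beta> s) \<and> (\<forall>\<gamma>\<in>\<Gamma>. mg \<gamma> x \<alpha> = mg \<gamma> y \<beta>)}"

definition left_class where
  "left_class S \<Gamma> ms mg x \<alpha> = left_rel S \<Gamma> ms mg `` {(x, \<alpha>)}"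

definition left_op :: "'s set \<Rightarrow> 'g set \<Rightarrow> ('s \<Rightarrow> 'g \<Rightarrow> 's \<Rightarrow> 's) \<Rightarrow> ('g \<Rightarrow> 's \<Rightarrow> 'g \<Rightarrow> 'g)
    \<Rightarrow> ('s \<times> 'g) set set" where
  "left_op S \<Gamma> ms mg = {left_class S \<Gamma> ms mg x \<alpha> |x \<alpha>. x \<in> S \<and> \<alpha> \<in> \<Gamma>}"

text \<open>The product of two classes is the union of the classes of all products of
  representatives; the union collapses to a single class, see \<open>left_mult_class\<close> below.\<close>

definition left_mult where
  "left_mult S \<Gamma> ms mg A B =
     (\<Union>(x, \<alpha>)\<in>A. \<Union>(y, \<beta>)\<in>B. left_class S \<Gamma> ms mg (ms x \<alpha> y) \<beta>)"

definition right_rel where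
  "right_rel S \<Gamma> ms mg = {((\<alpha>, a), (\<beta>, b)).
     \<alpha> \<in> \<Gamma> \<and> a \<in> S \<and> \<beta> \<in> \<Gamma> \<and> b \<in> S \<and>
     (\<forall>s\<in>S. ms s \<alpha> a = ms s \<beta> b) \<and> (\<forall>\<gamma>\<in>\<Gamma>. mg \<alpha> a \<gamma> = mg \<beta> b \<gamma>)}"

definition right_class where
  "right_class S \<Gamma> ms mg \<alpha> a = right_rel S \<Gamma> ms mg `` {(\<alpha>, a)}"

definition right_op :: "'s set \<Rightarrow> 'g set \<Rightarrow> ('s \<Rightarrow> 'g \<Rightarrow> 's \<Rightarrow> 's) \<Rightarrow> ('g \<Rightarrow> 's \<Rightarrow> 'g \<Rightarrow> 'g)
    \<Rightarrow> ('g \<times> 's) set set" where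
  "right_op S \<Gamma> ms mg = {right_class S \<Gamma> ms mg \<alpha> a |\<alpha> a. \<alpha> \<in> \<Gamma> \<and> a \<in> S}"

definition right_mult where
  "right_mult S \<Gamma> ms mg A B =
     (\<Union>(\<alpha>, a)\<in>A. \<Union>(\<beta>, b)\<in>B. right_class S \<Gamma> ms mg (mg \<alpha> a \<beta>) b)"

definition is_left_unity where
  "is_left_unity S \<Gamma> ms mg u \<longleftrightarrow> u \<in> left_op S \<Gamma> ms mg \<and>
     (\<exists>e\<in>S. \<exists>\<delta>\<in>\<Gamma>. u = left_class S \<Gamma> ms mg e \<delta> \<and> (\<forall>s\<in>S. ms e \<delta> s = s))"

definition is_right_unity where
  "is_right_unity S \<Gamma> ms mg u \<longleftrightarrow> u \<in> right_op S \<Gamma> ms mg \<and>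
     (\<exists>\<gamma>\<in>\<Gamma>. \<exists>f\<in>S. u = right_class S \<Gamma> ms mg \<gamma> f \<and> (\<forall>s\<in>S. ms s \<gamma> f = s))"

definition with_unities where
  "with_unities S \<Gamma> ms mg \<longleftrightarrow>
     (\<exists>u. is_left_unity S \<Gamma> ms mg u) \<and> (\<exists>v. is_right_unity S \<Gamma> ms mg v)"

text \<open>Fuzzy subsets of \<open>X\<close> are total functions on the ambient type; only their values on
  \<open>X \<times> Q\<close> matter.\<close>

definition fuzzy_subset :: "'x set \<Rightarrow> 'q set \<Rightarrow> ('x \<times> 'q \<Rightarrow> real) \<Rightarrow> bool" where
  "fuzzy_subset X Q \<mu> \<longleftrightarrow> \<mu> \<in> X \<times> Q \<rightarrow> {0..1}"

definition nonempty_fuzzy_subset :: "'x set \<Rightarrow> 'q set \<Rightarrow> ('x \<times> 'q \<Rightarrow> real) \<Rightarrow> bool" where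
  "nonempty_fuzzy_subset X Q \<mu> \<longleftrightarrow> fuzzy_subset X Q \<mu> \<and> (\<exists>x\<in>X. \<exists>q\<in>Q. \<mu> (x, q) \<noteq> 0)"

definition gamma_fuzzy_left_ideal where
  "gamma_fuzzy_left_ideal S \<Gamma> ms Q \<mu> \<longleftrightarrow> nonempty_fuzzy_subset S Q \<mu> \<and>
     (\<forall>x\<in>S. \<forall>y\<in>S. \<forall>\<gamma>\<in>\<Gamma>. \<forall>q\<in>Q. \<mu> (ms x \<gamma> y, q) \<ge> \<mu> (y, q))"

definition gamma_fuzzy_right_ideal where
  "gamma_fuzzy_right_ideal S \<Gamma> ms Q \<mu> \<longleftrightarrow> nonempty_fuzzy_subset S Q \<mu> \<and>
     (\<forall>x\<in>S. \<forall>y\<in>S. \<forall>\<gamma>\<in>\<Gamma>. \<forall>q\<in>Q. \<mu> (ms x \<gamma> y, q) \<ge> \<mu> (x, q))"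

definition gamma_fuzzy_ideal where
  "gamma_fuzzy_ideal S \<Gamma> ms Q \<mu> \<longleftrightarrow>
     gamma_fuzzy_left_ideal S \<Gamma> ms Q \<mu> \<and> gamma_fuzzy_right_ideal S \<Gamma> ms Q \<mu>"

definition semigroup_fuzzy_left_ideal where
  "semigroup_fuzzy_left_ideal T mult Q \<mu> \<longleftrightarrow> nonempty_fuzzy_subset T Q \<mu> \<and>
     (\<forall>x\<in>T. \<forall>y\<in>T. \<forall>q\<in>Q. \<mu> (mult x y, q) \<ge> \<mu> (y, q))"

definition semigroup_fuzzy_right_ideal where
  "semigroup_fuzzy_right_ideal T mult Q \<mu> \<longleftrightarrow> nonempty_fuzzy_subset T Q \<mu> \<and>
     (\<forall>x\<in>T. \<forall>y\<in>T. \<forall>q\<in>Q. \<mu> (mult x y, q) \<ge> \<mu> (x, q))"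

definition semigroup_fuzzy_ideal where
  "semigroup_fuzzy_ideal T mult Q \<mu> \<longleftrightarrow>
     semigroup_fuzzy_left_ideal T mult Q \<mu> \<and> semigroup_fuzzy_right_ideal T mult Q \<mu>"

text \<open>The infimum is taken in the conditionally complete reals; it is a genuine infimum on
  \<open>S \<times> Q\<close> because \<open>\<Gamma>\<close> is non-empty and fuzzy subsets take values in \<open>[0, 1]\<close>.\<close>

definition fuzzy_plus where
  "fuzzy_plus S \<Gamma> ms mg (\<delta> :: ('s \<times> 'g) set \<times> 'q \<Rightarrow> real) =
     (\<lambda>(a :: 's, q). INF \<gamma>\<in>\<Gamma>. \<delta> (left_class S \<Gamma> ms mg a \<gamma>, q))"

context gamma_semigroup
begin

lemma left_rel_equiv: "equiv (S \<times> \<Gamma>) (left_rel S \<Gamma> ms mg)"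
  by (rule equivI) (auto simp: left_rel_def refl_on_def sym_def trans_def)

lemma right_rel_equiv: "equiv (\<Gamma> \<times> S) (right_rel S \<Gamma> ms mg)"
  by (rule equivI) (auto simp: right_rel_def refl_on_def sym_def trans_def)

lemma left_op_quotient: "left_op S \<Gamma> ms mg = (S \<times> \<Gamma>) // left_rel S \<Gamma> ms mg"
  by (auto simp: left_op_def left_class_def quotient_def)

lemma right_op_quotient: "right_op S \<Gamma> ms mg = (\<Gamma> \<times> S) // right_rel S \<Gamma> ms mg"
  by (auto simp: right_op_def right_class_def quotient_def)

lemma left_mult_class:
  assumes "x \<in> S" "\<alpha> \<in> \<Gamma>" "y \<in> S" "\<beta> \<in> \<Gamma>"
  shows "left_mult S \<Gamma> ms mg (left_class S \<Gamma> ms mg x \<alpha>) (left_class S \<Gamma> ms mg y \<beta>)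
    = left_class S \<Gamma> ms mg (ms x \<alpha> y) \<beta>"
proof -
  let ?r = "left_rel S \<Gamma> ms mg"
  have cong: "left_class S \<Gamma> ms mg (ms x' \<alpha>' y') \<beta>' = left_class S \<Gamma> ms mg (ms x \<alpha> y) \<beta>"
    if "((x, \<alpha>), (x', \<alpha>')) \<in> ?r" "((y, \<beta>), (y', \<beta>')) \<in> ?r" for x' \<alpha>' y' \<beta>'
  proof -
    have *: "x' \<in> S" "\<alpha>' \<in> \<Gamma>" "y' \<in> S" "\<beta>' \<in> \<Gamma>"
      "\<And>s. s \<in> S \<Longrightarrow> ms x \<alpha> s = ms x' \<alpha>' s" "\<And>\<gamma>. \<gamma> \<in> \<Gamma> \<Longrightarrow> mg \<gamma> x \<alpha> = mg \<gamma> x' \<alpha>'"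
      "\<And>s. s \<in> S \<Longrightarrow> ms y \<beta> s = ms y' \<beta>' s" "\<And>\<gamma>. \<gamma> \<in> \<Gamma> \<Longrightarrow> mg \<gamma> y \<beta> = mg \<gamma> y' \<beta>'"
      using that by (auto simp: left_rel_def)
    have "((ms x \<alpha> y, \<beta>), (ms x' \<alpha>' y', \<beta>')) \<in> ?r"
      using assms * by (simp add: left_rel_def ms_closed mg_closed ms_assoc1 ms_assoc2 mg_assoc1)
    then show ?thesis
      unfolding left_class_def using equiv_class_eq[OF left_rel_equiv] by metis
  qed
  have refl: "((x, \<alpha>), (x, \<alpha>)) \<in> ?r" "((y, \<beta>), (y, \<beta>)) \<in> ?r"
    using assms by (auto simp: left_rel_def)
  have mem: "(p \<in> left_class S \<Gamma> ms mg u v) = (((u, v), p) \<in> ?r)" for p u v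
    by (simp add: left_class_def)
  show ?thesis
  proof (rule set_eqI, rule iffI)
    fix p
    assume "p \<in> left_mult S \<Gamma> ms mg (left_class S \<Gamma> ms mg x \<alpha>)
      (left_class S \<Gamma> ms mg y \<beta>)"
    then obtain u v u' v' where "(((x, \<alpha>), (u, v)) \<in> ?r)" "(((y, \<beta>), (u', v')) \<in> ?r)"
      "p \<in> left_class S \<Gamma> ms mg (ms u v u') v'"
      unfolding left_mult_def by (auto simp: mem)
    with cong show "p \<in> left_class S \<Gamma> ms mg (ms x \<alpha> y) \<beta>"
      by metis
  next
    fix p
    assume "p \<in> left_class S \<Gamma> ms mg (ms x \<alpha> y) \<beta>"
    then show "p \<in> left_mult S \<Gamma> ms mg (left_class S \<Gamma> ms mg x \<alpha>)
      (left_class S \<Gamma> ms mg y \<beta>)"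
      unfolding left_mult_def
      by (intro UN_I[of "(x, \<alpha>)"], simp only: mem refl, unfold case_prod_conv,
          intro UN_I[of "(y, \<beta>)"]) (simp_all only: mem refl case_prod_conv)
  qed
qed

lemma right_mult_class:
  assumes "\<alpha> \<in> \<Gamma>" "a \<in> S" "\<beta> \<in> \<Gamma>" "b \<in> S"
  shows "right_mult S \<Gamma> ms mg (right_class S \<Gamma> ms mg \<alpha> a) (right_class S \<Gamma> ms mg \<beta> b)
    = right_class S \<Gamma> ms mg (mg \<alpha> a \<beta>) b"
proof -
  let ?r = "right_rel S \<Gamma> ms mg"
  have cong: "right_class S \<Gamma> ms mg (mg \<alpha>' a' \<beta>') b' = right_class S \<Gamma> ms mg (mg \<alpha> a \<beta>) b"
    if "((\<alpha>, a), (\<alpha>', a')) \<in> ?r" "((\<beta>, b), (\<beta>', b')) \<in> ?r" for \<alpha>' a' \<beta>' b'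
  proof -
    have *: "\<alpha>' \<in> \<Gamma>" "a' \<in> S" "\<beta>' \<in> \<Gamma>" "b' \<in> S"
      "\<And>s. s \<in> S \<Longrightarrow> ms s \<alpha> a = ms s \<alpha>' a'" "\<And>\<gamma>. \<gamma> \<in> \<Gamma> \<Longrightarrow> mg \<alpha> a \<gamma> = mg \<alpha>' a' \<gamma>"
      "\<And>s. s \<in> S \<Longrightarrow> ms s \<beta> b = ms s \<beta>' b'" "\<And>\<gamma>. \<gamma> \<in> \<Gamma> \<Longrightarrow> mg \<beta> b \<gamma> = mg \<beta>' b' \<gamma>"
      using that by (auto simp: right_rel_def)
    have "((mg \<alpha> a \<beta>, b), (mg \<alpha>' a' \<beta>', b')) \<in> ?r"
      using assms * 
      by (simp add: right_rel_def ms_closed mg_closed ms_assoc1[symmetric] mg_assoc2)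
    then show ?thesis
      unfolding right_class_def using equiv_class_eq[OF right_rel_equiv] by metis
  qed
  have refl: "((\<alpha>, a), (\<alpha>, a)) \<in> ?r" "((\<beta>, b), (\<beta>, b)) \<in> ?r"
    using assms by (auto simp: right_rel_def)
  have mem: "(p \<in> right_class S \<Gamma> ms mg u v) = (((u, v), p) \<in> ?r)" for p u v
    by (simp add: right_class_def)
  show ?thesis
  proof (rule set_eqI, rule iffI)
    fix p
    assume "p \<in> right_mult S \<Gamma> ms mg (right_class S \<Gamma> ms mg \<alpha> a)
      (right_class S \<Gamma> ms mg \<beta> b)"
    then obtain u v u' v' where "(((\<alpha>, a), (u, v)) \<in> ?r)" "(((\<beta>, b), (u', v')) \<in> ?r)"
      "p \<in> right_class S \<Gamma> ms mg (mg u v u') v'"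
      unfolding right_mult_def by (auto simp: mem)
    with cong show "p \<in> right_class S \<Gamma> ms mg (mg \<alpha> a \<beta>) b"
      by metis
  next
    fix p
    assume "p \<in> right_class S \<Gamma> ms mg (mg \<alpha> a \<beta>) b"
    then show "p \<in> right_mult S \<Gamma> ms mg (right_class S \<Gamma> ms mg \<alpha> a)
      (right_class S \<Gamma> ms mg \<beta> b)"
      unfolding right_mult_def
      by (intro UN_I[of "(\<alpha>, a)"], simp only: mem refl, unfold case_prod_conv,
          intro UN_I[of "(\<beta>, b)"]) (simp_all only: mem refl case_prod_conv)
  qed
qed

lemma left_mult_closed:
  "\<lbrakk>A \<in> left_op S \<Gamma> ms mg; B \<in> left_op S \<Gamma> ms mg\<rbrakk>
    \<Longrightarrow> left_mult S \<Gamma> ms mg A B \<in> left_op S \<Gamma> ms mg"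
  unfolding left_op_def using left_mult_class ms_closed by fastforce

lemma left_mult_assoc:
  "\<lbrakk>A \<in> left_op S \<Gamma> ms mg; B \<in> left_op S \<Gamma> ms mg; C \<in> left_op S \<Gamma> ms mg\<rbrakk>
    \<Longrightarrow> left_mult S \<Gamma> ms mg (left_mult S \<Gamma> ms mg A B) C
      = left_mult S \<Gamma> ms mg A (left_mult S \<Gamma> ms mg B C)"
  unfolding left_op_def
  by (auto simp: left_mult_class ms_closed ms_assoc1 ms_assoc2)

end

end

theory Submission
  imports Defs
begin

text \<open>In \<open>L\<close> one has \<open>[x\<gamma>y, \<beta>] = [x, \<gamma>][y, \<beta>]\<close>, so for every \<open>\<beta>\<close> the ideal
  properties of \<open>\<delta>\<close> bound \<open>\<delta>([x\<gamma>y, \<beta>], q)\<close> below by \<open>\<delta>([x, \<gamma>], q) \<ge> \<delta>\<^sup>+(x, q)\<close>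
  and by \<open>\<delta>([y, \<beta>], q) \<ge> \<delta>\<^sup>+(y, q)\<close> respectively; take the infimum over \<open>\<beta>\<close>. If
  \<open>\<delta>([x, \<gamma>], q) \<noteq> 0\<close>, the same bound makes \<open>\<delta>\<^sup>+\<close> positive at \<open>(x\<gamma>s, q)\<close> for any
  \<open>s \<in> S\<close>.\<close>

context gamma_semigroup
begin

lemma left_class_in_left_op:
  "\<lbrakk>x \<in> S; \<alpha> \<in> \<Gamma>\<rbrakk> \<Longrightarrow> left_class S \<Gamma> ms mg x \<alpha> \<in> left_op S \<Gamma> ms mg"
  by (auto simp: left_op_def)

lemma fuzzy_subset_left_class:
  assumes "fuzzy_subset (left_op S \<Gamma> ms mg) Q \<delta>" "x \<in> S" "\<alpha> \<in> \<Gamma>" "q \<in> Q"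
  shows "0 \<le> \<delta> (left_class S \<Gamma> ms mg x \<alpha>, q)" "\<delta> (left_class S \<Gamma> ms mg x \<alpha>, q) \<le> 1"
proof -
  have "\<delta> (left_class S \<Gamma> ms mg x \<alpha>, q) \<in> {0..1}"
    using assms left_class_in_left_op unfolding fuzzy_subset_def by blast
  then show "0 \<le> \<delta> (left_class S \<Gamma> ms mg x \<alpha>, q)" "\<delta> (left_class S \<Gamma> ms mg x \<alpha>, q) \<le> 1"
    by auto
qed

text \<open>In the conditionally complete reals an \<open>INF\<close> lies below its terms only for
  a family bounded below; the values of \<delta> are bounded below by 0.\<close>

lemma fuzzy_plus_le:
  assumes "fuzzy_subset (left_op S \<Gamma> ms mg) Q \<delta>" "x \<in> S" "\<alpha> \<in> \<Gamma>" "q \<in> Q"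
  shows "fuzzy_plus S \<Gamma> ms mg \<delta> (x, q) \<le> \<delta> (left_class S \<Gamma> ms mg x \<alpha>, q)"
proof -
  have "bdd_below ((\<lambda>\<gamma>. \<delta> (left_class S \<Gamma> ms mg x \<gamma>, q)) ` \<Gamma>)"
    using fuzzy_subset_left_class(1)[OF assms(1,2) _ assms(4)] by (rule bdd_belowI2)
  then show ?thesis
    unfolding fuzzy_plus_def prod.case using \<open>\<alpha> \<in> \<Gamma>\<close> by (rule cINF_lower)
qed

text \<open>Rests on \<Gamma> being non-empty: over an empty index set a real \<open>INF\<close>
  need not dominate such bounds.\<close>

lemma fuzzy_plus_greatest:
  assumes "\<And>\<gamma>. \<gamma> \<in> \<Gamma> \<Longrightarrow> c \<le> \<delta> (left_class S \<Gamma> ms mg x \<gamma>, q)"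
  shows "c \<le> fuzzy_plus S \<Gamma> ms mg \<delta> (x, q)"
  unfolding fuzzy_plus_def using assms by (simp add: cINF_greatest \<Gamma>_nonempty)

lemma fuzzy_subset_fuzzy_plus:
  assumes "fuzzy_subset (left_op S \<Gamma> ms mg) Q \<delta>"
  shows "fuzzy_subset S Q (fuzzy_plus S \<Gamma> ms mg \<delta>)"
proof -
  have "fuzzy_plus S \<Gamma> ms mg \<delta> (x, q) \<in> {0..1}" if "x \<in> S" "q \<in> Q" for x q
  proof -
    \<comment> \<open>The upper bound 1 passes to the infimum through any single term.\<close>
    obtain \<gamma> where "\<gamma> \<in> \<Gamma>" using \<Gamma>_nonempty by blast
    then have "fuzzy_plus S \<Gamma> ms mg \<delta> (x, q) \<le> 1"
      using fuzzy_plus_le[OF assms, of x \<gamma> q] fuzzy_subset_left_class(2)[OF assms, of x \<gamma> q] that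
      by linarith
    moreover have "0 \<le> fuzzy_plus S \<Gamma> ms mg \<delta> (x, q)"
      using fuzzy_subset_left_class(1)[OF assms] that by (simp add: fuzzy_plus_greatest)
    ultimately show ?thesis by simp
  qed
  then show ?thesis unfolding fuzzy_subset_def by blast
qed

text \<open>The left factor of [x,\<gamma>][y,\<beta>] = [x\<gamma>y,\<beta>] does not depend on
  \<beta>, so one value of \<delta> bounds the whole infimum. This serves both for monotonicity and
  for non-vanishing.\<close>

lemma right_ideal_le_fuzzy_plus:
  assumes "semigroup_fuzzy_right_ideal (left_op S \<Gamma> ms mg) (left_mult S \<Gamma> ms mg) Q \<delta>"
    and "x \<in> S" "\<gamma> \<in> \<Gamma>" "y \<in> S" "q \<in> Q"
  shows "\<delta> (left_class S \<Gamma> ms mg x \<gamma>, q) \<le> fuzzy_plus S \<Gamma> ms mg \<delta> (ms x \<gamma> y, q)"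
proof (rule fuzzy_plus_greatest)
  fix \<beta> assume "\<beta> \<in> \<Gamma>"
  then have "left_class S \<Gamma> ms mg (ms x \<gamma> y) \<beta> =
      left_mult S \<Gamma> ms mg (left_class S \<Gamma> ms mg x \<gamma>) (left_class S \<Gamma> ms mg y \<beta>)"
    using assms by (simp add: left_mult_class)
  then show "\<delta> (left_class S \<Gamma> ms mg x \<gamma>, q) \<le> \<delta> (left_class S \<Gamma> ms mg (ms x \<gamma> y) \<beta>, q)"
    using assms \<open>\<beta> \<in> \<Gamma>\<close> by (simp add: semigroup_fuzzy_right_ideal_def left_class_in_left_op)
qed

lemma fuzzy_plus_right_ideal:
  assumes \<delta>: "semigroup_fuzzy_right_ideal (left_op S \<Gamma> ms mg) (left_mult S \<Gamma> ms mg) Q \<delta>"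
  shows "gamma_fuzzy_right_ideal S \<Gamma> ms Q (fuzzy_plus S \<Gamma> ms mg \<delta>)"
proof -
  have fuzzy: "fuzzy_subset (left_op S \<Gamma> ms mg) Q \<delta>"
    using \<delta> by (simp add: semigroup_fuzzy_right_ideal_def nonempty_fuzzy_subset_def)
  obtain x \<alpha> q where x: "x \<in> S" "\<alpha> \<in> \<Gamma>" "q \<in> Q" "\<delta> (left_class S \<Gamma> ms mg x \<alpha>, q) \<noteq> 0"
    using \<delta>
    by (auto simp: semigroup_fuzzy_right_ideal_def nonempty_fuzzy_subset_def left_op_def)
  \<comment> \<open>A nonzero value of \<delta> is positive, as \<delta> is nonnegative on L;
    \<open>x\<close> doubles as the right factor, where any element of S would do.\<close>
  then have "0 < fuzzy_plus S \<Gamma> ms mg \<delta> (ms x \<alpha> x, q)"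
    using fuzzy_subset_left_class(1)[OF fuzzy, of x \<alpha> q] right_ideal_le_fuzzy_plus[OF \<delta>, of x \<alpha> x q]
    by linarith
  then have "fuzzy_plus S \<Gamma> ms mg \<delta> (ms x \<alpha> x, q) \<noteq> 0"
    by simp
  then have "nonempty_fuzzy_subset S Q (fuzzy_plus S \<Gamma> ms mg \<delta>)"
    unfolding nonempty_fuzzy_subset_def
    using fuzzy_subset_fuzzy_plus[OF fuzzy] x ms_closed[of x \<alpha> x] by blast
  \<comment> \<open>The two inequalities are chained through the value of \<delta> at
    [x,\<gamma>].\<close>
  then show ?thesis
    unfolding gamma_fuzzy_right_ideal_def
    by (auto intro: order_trans[OF fuzzy_plus_le[OF fuzzy] right_ideal_le_fuzzy_plus[OF \<delta>]])
qed

text \<open>Here the factor [y,\<beta>] varies with \<beta>, so the two infima are compared term by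
  term.\<close>

lemma fuzzy_plus_le_mult_left:
  assumes \<delta>: "semigroup_fuzzy_left_ideal (left_op S \<Gamma> ms mg) (left_mult S \<Gamma> ms mg) Q \<delta>"
    and "x \<in> S" "\<gamma> \<in> \<Gamma>" "y \<in> S" "q \<in> Q"
  shows "fuzzy_plus S \<Gamma> ms mg \<delta> (y, q) \<le> fuzzy_plus S \<Gamma> ms mg \<delta> (ms x \<gamma> y, q)"
proof (rule fuzzy_plus_greatest)
  fix \<beta> assume "\<beta> \<in> \<Gamma>"
  have "fuzzy_plus S \<Gamma> ms mg \<delta> (y, q) \<le> \<delta> (left_class S \<Gamma> ms mg y \<beta>, q)"
    using assms \<open>\<beta> \<in> \<Gamma>\<close>
    by (intro fuzzy_plus_le) (auto simp: semigroup_fuzzy_left_ideal_def nonempty_fuzzy_subset_def)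
  also have "\<dots> \<le> \<delta> (left_mult S \<Gamma> ms mg (left_class S \<Gamma> ms mg x \<gamma>)
      (left_class S \<Gamma> ms mg y \<beta>), q)"
    using assms \<open>\<beta> \<in> \<Gamma>\<close> by (simp add: semigroup_fuzzy_left_ideal_def left_class_in_left_op)
  also have "\<dots> = \<delta> (left_class S \<Gamma> ms mg (ms x \<gamma> y) \<beta>, q)"
    using assms \<open>\<beta> \<in> \<Gamma>\<close> by (simp add: left_mult_class)
  finally show "fuzzy_plus S \<Gamma> ms mg \<delta> (y, q) \<le> \<delta> (left_class S \<Gamma> ms mg (ms x \<gamma> y) \<beta>, q)" .
qed

text \<open>The left half adds only an inequality; that \<delta>+ is a non-empty fuzzy subset comes
  from the right half.\<close>

lemma fuzzy_plus_ideal: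
  assumes "semigroup_fuzzy_ideal (left_op S \<Gamma> ms mg) (left_mult S \<Gamma> ms mg) Q \<delta>"
  shows "gamma_fuzzy_ideal S \<Gamma> ms Q (fuzzy_plus S \<Gamma> ms mg \<delta>)"
  using assms fuzzy_plus_right_ideal[of Q \<delta>] fuzzy_plus_le_mult_left[of Q \<delta>]
  by (simp add: semigroup_fuzzy_ideal_def gamma_fuzzy_ideal_def gamma_fuzzy_left_ideal_def
      gamma_fuzzy_right_ideal_def)

end

theorem proposition5p11:
  fixes S :: "'s set" and \<Gamma> :: "'g set" and Q :: "'q set"
    and ms :: "'s \<Rightarrow> 'g \<Rightarrow> 's \<Rightarrow> 's"
    and mg :: "'g \<Rightarrow> 's \<Rightarrow> 'g \<Rightarrow> 'g"
    and \<delta> :: "('s \<times> 'g) set \<times> 'q \<Rightarrow> real"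
  assumes "gamma_semigroup S \<Gamma> ms mg"
    and "with_unities S \<Gamma> ms mg"
    and "Q \<noteq> {}"
  shows "(semigroup_fuzzy_ideal (left_op S \<Gamma> ms mg) (left_mult S \<Gamma> ms mg) Q \<delta> \<longrightarrow>
            gamma_fuzzy_ideal S \<Gamma> ms Q (fuzzy_plus S \<Gamma> ms mg \<delta>)) \<and>
         (semigroup_fuzzy_right_ideal (left_op S \<Gamma> ms mg) (left_mult S \<Gamma> ms mg) Q \<delta> \<longrightarrow>
            gamma_fuzzy_right_ideal S \<Gamma> ms Q (fuzzy_plus S \<Gamma> ms mg \<delta>))"
  using gamma_semigroup.fuzzy_plus_ideal[OF assms(1)]
    gamma_semigroup.fuzzy_plus_right_ideal[OF assms(1)]
  by blast

end
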